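(* Let $G=(V,E)$ be a finite connected weighted graph satisfying $CD(m,\kappa)$, where $m\in(1,\infty]$ and $\kappa\in\mathbb{R}$. Let $f:V\to\mathbb{R}$ be a harmonic eigenfunction of the Laplacian $\Delta$ with nontrivial eigenvalue $\lambda\neq 0$. Then for all $x\in V$, $$|\nabla f|^2(x)\le \Big(\big(8-\tfrac{2}{m}\big)\lambda-4\kappa\Big)\cdot\max_{z\in V}f^2(z).$$
   Context: $G$ is an undirected finite connected graph with at least two vertices, vertex set $V$, edge set $E$, and positive symmetric edge weights $w_{xy}=w_{yx}>0$ for adjacent $x\sim y$; the degree is $d_x=\sum_{y\sim x}w_{xy}$. For $f:V\to\mathbb{R}$, $\Delta f(x)=\frac1{d_x}\sum_{y\sim x}w_{xy}(f(y)-f(x))$ and $|\nabla f|^2(x)=\frac1{d_x}\sum_{y\sim x}w_{xy}(f(x)-f(y))^2$. A harmonic eigenfunction with eigenvalue $\lambda$ is a function $f\not\equiv 0$ with $-\Delta f(x)=\lambda f(x)$ for all $x\in V$. Define $\Gamma(f,g)=\frac12\{\Delta(fg)-f\Delta g-g\Delta f\}$ and $\Gamma_2(f,g)=\frac12\{\Delta\Gamma(f,g)-\Gamma(f,\Delta g)-\Gamma(g,\Delta f)\}$; one has $\Gamma(f,f)=\frac12|\nabla f|^2$. The graph $G$ (equivalently $\Delta$) satisfies $CD(m,\kappa)$ if $\Gamma_2(f,f)(x)\ge\frac1m(\Delta f(x))^2+\kappa\,\Gamma(f,f)(x)$ for all $f:V\to\mathbb{R}$ and all $x\in V$. For $m=\infty$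 the convention is $\frac1m=0$, i.e. $CD(\infty,\kappa)$ means $\Gamma_2(f,f)\ge\kappa\,\Gamma(f,f)$. *)

theory Defs
  imports "HOL-Library.Extended_Real"
begin

(* An undirected edge between x and y is encoded by the two pairs (x, y) and (y, x).
   Loops are neither required nor excluded. Values of w outside E are irrelevant. *)
locale weighted_graph =
  fixes V :: "'a set" and E :: "('a \<times> 'a) set" and w :: "'a \<Rightarrow> 'a \<Rightarrow> real"
  assumes finite_V: "finite V"
    and card_V: "2 \<le> card V"
    and edges: "E \<subseteq> V \<times> V"
    and undirected: "sym E"
    and connected: "x \<in> V \<Longrightarrow> y \<in> V \<Longrightarrow> (x, y) \<in> E\<^sup>*"
    and weight_pos: "(x, y) \<in> E \<Longrightarrow> 0 < w x y"
    and weight_sym: "(x, y) \<in> E \<Longrightarrow> w x y = w y x"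

definition degree :: "('a \<times> 'a) set \<Rightarrow> ('a \<Rightarrow> 'a \<Rightarrow> real) \<Rightarrow> 'a \<Rightarrow> real" where
  "degree E w x = (\<Sum>y | (x, y) \<in> E. w x y)"

(* A function on V is represented by a function on the whole type; in a weighted graph, the
   operators below evaluated at a vertex only depend on its values on V, as E is contained
   in V \<times> V. *)
definition laplacian ::
  "('a \<times> 'a) set \<Rightarrow> ('a \<Rightarrow> 'a \<Rightarrow> real) \<Rightarrow> ('a \<Rightarrow> real) \<Rightarrow> 'a \<Rightarrow> real" where
  "laplacian E w f x = 1 / degree E w x * (\<Sum>y | (x, y) \<in> E. w x y * (f y - f x))"

definition grad_sq ::
  "('a \<times> 'a) set \<Rightarrow> ('a \<Rightarrow> 'a \<Rightarrow> real) \<Rightarrow> ('a \<Rightarrow> real) \<Rightarrow> 'a \<Rightarrow> real" where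
  "grad_sq E w f x = 1 / degree E w x * (\<Sum>y | (x, y) \<in> E. w x y * (f x - f y)\<^sup>2)"

definition Gam ::
  "('a \<times> 'a) set \<Rightarrow> ('a \<Rightarrow> 'a \<Rightarrow> real) \<Rightarrow> ('a \<Rightarrow> real) \<Rightarrow> ('a \<Rightarrow> real) \<Rightarrow> 'a \<Rightarrow> real" where
  "Gam E w f g x =
     1 / 2 * (laplacian E w (\<lambda>z. f z * g z) x - f x * laplacian E w g x - g x * laplacian E w f x)"

definition Gam2 ::
  "('a \<times> 'a) set \<Rightarrow> ('a \<Rightarrow> 'a \<Rightarrow> real) \<Rightarrow> ('a \<Rightarrow> real) \<Rightarrow> ('a \<Rightarrow> real) \<Rightarrow> 'a \<Rightarrow> real" where
  "Gam2 E w f g x =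
     1 / 2 * (laplacian E w (Gam E w f g) x - Gam E w f (laplacian E w g) x
              - Gam E w g (laplacian E w f) x)"

(* The dimension m is an extended real: in ereal, 1 / \<infinity> = 0, so m = \<infinity> gives
   the usual convention for CD(\<infinity>, \<kappa>). *)
definition CD ::
  "'a set \<Rightarrow> ('a \<times> 'a) set \<Rightarrow> ('a \<Rightarrow> 'a \<Rightarrow> real) \<Rightarrow> ereal \<Rightarrow> real \<Rightarrow> bool" where
  "CD V E w m \<kappa> \<longleftrightarrow>
     (\<forall>f. \<forall>x\<in>V. Gam2 E w f f x \<ge> real_of_ereal (1 / m) * (laplacian E w f x)\<^sup>2 + \<kappa> * Gam E w f f x)"

definition harmonic_eigenfunction ::
  "'a set \<Rightarrow> ('a \<times> 'a) set \<Rightarrow> ('a \<Rightarrow> 'a \<Rightarrow> real) \<Rightarrow> real \<Rightarrow> ('a \<Rightarrow> real) \<Rightarrow> bool" where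
  "harmonic_eigenfunction V E w lam f \<longleftrightarrow>
     (\<exists>x\<in>V. f x \<noteq> 0) \<and> (\<forall>x\<in>V. - laplacian E w f x = lam * f x)"

end

(* With g = |grad f|^2, the curvature condition gives
   Delta g >= (4/m) lam^2 f^2 + 2 (kappa - lam) g, while Delta (f^2) = g - 2 lam f^2.
   The maximum principle for f^2 gives lam > 0, and for g it gives kappa <= lam.
   Apply it finally to h = g + (4 lam - 2 kappa) f^2: the factor 4 lam - 2 kappa is chosen so that
   at a maximum point x of h the coefficient of g becomes 2 lam, whence
   g(x) <= (4 lam - 2 kappa - 2 lam / m) f(x)^2. As 4 lam - 2 kappa >= 0, everywhere
   g <= h <= h(x) <= (8 lam - 4 kappa - 2 lam / m) f(x)^2. *)

theory Submission
  imports Defs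
begin

lemma laplacian_add:
  "laplacian E w (\<lambda>z. f z + g z) x = laplacian E w f x + laplacian E w g x"
proof -
  have "(\<Sum>y | (x, y) \<in> E. w x y * (f y + g y - (f x + g x)))
      = (\<Sum>y | (x, y) \<in> E. w x y * (f y - f x)) + (\<Sum>y | (x, y) \<in> E. w x y * (g y - g x))"
    unfolding sum.distrib[symmetric] by (rule sum.cong) (simp_all add: algebra_simps)
  then show ?thesis
    unfolding laplacian_def by (simp only: distrib_left)
qed

lemma laplacian_cmult: "laplacian E w (\<lambda>z. c * f z) x = c * laplacian E w f x"
proof -
  have "(\<Sum>y | (x, y) \<in> E. w x y * (c * f y - c * f x))
      = c * (\<Sum>y | (x, y) \<in> E. w x y * (f y - f x))"
    unfolding sum_distrib_left by (rule sum.cong) (simp_all add: algebra_simps)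
  then show ?thesis
    unfolding laplacian_def by simp
qed

text \<open>Edge by edge this is
  \<open>b\<^sup>2 - a\<^sup>2 = 2 * a * (b - a) + (a - b)\<^sup>2\<close>, the discrete substitute
  for the chain rule.\<close>

lemma laplacian_power2:
  "laplacian E w (\<lambda>z. (f z)\<^sup>2) x = 2 * f x * laplacian E w f x + grad_sq E w f x"
proof -
  have "(\<Sum>y | (x, y) \<in> E. w x y * ((f y)\<^sup>2 - (f x)\<^sup>2))
      = 2 * f x * (\<Sum>y | (x, y) \<in> E. w x y * (f y - f x))
        + (\<Sum>y | (x, y) \<in> E. w x y * (f x - f y)\<^sup>2)"
    unfolding sum_distrib_left sum.distrib[symmetric]
    by (rule sum.cong) (simp_all add: power2_eq_square algebra_simps)
  then show ?thesis
    unfolding laplacian_def grad_sq_def by (simp add: algebra_simps add_divide_distrib)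
qed

lemma Gam_self: "Gam E w f f x = 1 / 2 * grad_sq E w f x"
  using laplacian_power2[of E w f x] by (simp add: Gam_def power2_eq_square)

context weighted_graph
begin

lemma degree_nonneg: "0 \<le> degree E w x"
  unfolding degree_def by (rule sum_nonneg) (auto dest: weight_pos)

lemma grad_sq_nonneg: "0 \<le> grad_sq E w f x"
  unfolding grad_sq_def
  by (intro mult_nonneg_nonneg sum_nonneg)
     (auto simp: degree_nonneg intro!: mult_nonneg_nonneg dest: weight_pos)

text \<open>A sum of nonnegative terms vanishes only termwise, so \<open>f\<close> takes the value
  \<open>f x\<close> at all neighbours of \<open>x\<close>.\<close>

lemma grad_sq_eq_0_imp_laplacian:
  assumes "grad_sq E w f x = 0"
  shows "laplacian E w f x = 0"
proof (cases "degree E w x = 0")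
  case False
  have fin: "finite {y. (x, y) \<in> E}"
    using edges by (auto intro: finite_subset[OF _ finite_V])
  have "(\<Sum>y | (x, y) \<in> E. w x y * (f x - f y)\<^sup>2) = 0"
    using assms False by (simp add: grad_sq_def)
  moreover have "0 \<le> w x y * (f x - f y)\<^sup>2" if "y \<in> {y. (x, y) \<in> E}" for y
    using that weight_pos[of x y] by simp
  ultimately have "\<forall>y\<in>{y. (x, y) \<in> E}. w x y * (f x - f y)\<^sup>2 = 0"
    by (simp only: sum_nonneg_eq_0_iff[OF fin])
  then have "(\<Sum>y | (x, y) \<in> E. w x y * (f y - f x)) = 0"
    by (intro sum.neutral) auto
  then show ?thesis
    by (simp add: laplacian_def)
\<comment> \<open>For degree 0 the factor \<open>1 / 0 = 0\<close> makes the Laplacian vanish by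
  convention.\<close>
qed (simp add: laplacian_def)

lemma V_nonempty: "V \<noteq> {}"
  using card_V by auto

text \<open>Neighbours of a vertex lie in \<open>V\<close>. This allows the eigenvalue equation,
  known only on \<open>V\<close>, to be used under a further Laplacian.\<close>

lemma laplacian_cong:
  assumes "x \<in> V" "\<And>z. z \<in> V \<Longrightarrow> f z = g z"
  shows "laplacian E w f x = laplacian E w g x"
proof -
  have "(\<Sum>y | (x, y) \<in> E. w x y * (f y - f x)) = (\<Sum>y | (x, y) \<in> E. w x y * (g y - g x))"
    using assms edges by (intro sum.cong) auto
  then show ?thesis
    unfolding laplacian_def by simp
qed

text \<open>A maximum point exists since \<open>V\<close> is finite and nonempty; there all
  differences along edges are nonpositive and carry positive weights.\<close>

lemma maximum_principle:
  fixes f :: "'a \<Rightarrow> real"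
  shows "\<exists>x\<in>V. (\<forall>y\<in>V. f y \<le> f x) \<and> laplacian E w f x \<le> 0"
proof -
  have "Max (f ` V) \<in> f ` V"
    using finite_V V_nonempty by simp
  then obtain x where x: "x \<in> V" "Max (f ` V) = f x"
    by auto
  then have max: "f y \<le> f x" if "y \<in> V" for y
    using finite_V that Max_ge[of "f ` V" "f y"] by simp
  have "(\<Sum>y | (x, y) \<in> E. w x y * (f y - f x)) \<le> 0"
    using edges max by (intro sum_nonpos mult_nonneg_nonpos) (auto dest: weight_pos)
  then have "laplacian E w f x \<le> 0"
    unfolding laplacian_def using degree_nonneg[of x] by (intro mult_nonneg_nonpos) auto
  with x(1) max show ?thesis
    by blast
qed

context
  fixes f :: "'a \<Rightarrow> real" and lam :: real
  assumes eigen: "\<And>x. x \<in> V \<Longrightarrow> laplacian E w f x = - lam * f x"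
begin

lemma eigen_laplacian_power2:
  assumes "x \<in> V"
  shows "laplacian E w (\<lambda>z. (f z)\<^sup>2) x = grad_sq E w f x - 2 * lam * (f x)\<^sup>2"
  unfolding laplacian_power2 eigen[OF assms] by (simp add: power2_eq_square)

lemma eigenvalue_pos:
  assumes "\<exists>x\<in>V. f x \<noteq> 0" "lam \<noteq> 0"
  shows "0 < lam"
proof -
  obtain z where z: "z \<in> V" "f z \<noteq> 0"
    using assms by blast
  obtain x where x: "x \<in> V" "\<And>y. y \<in> V \<Longrightarrow> (f y)\<^sup>2 \<le> (f x)\<^sup>2"
      "laplacian E w (\<lambda>z. (f z)\<^sup>2) x \<le> 0"
    using maximum_principle[of "\<lambda>z. (f z)\<^sup>2"] by blast
  have "0 < (f z)\<^sup>2"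
    using z by simp
  with x(2)[OF z(1)] have "0 < (f x)\<^sup>2"
    by linarith
  moreover have "0 \<le> lam * (f x)\<^sup>2"
    using x grad_sq_nonneg[of f x] by (simp add: eigen_laplacian_power2)
  ultimately show ?thesis
    using assms(2) by (simp add: zero_le_mult_iff)
qed

text \<open>A Bochner-type formula: since the Laplacian of \<open>f\<close> is
  \<open>- lam * f\<close> on \<open>V\<close>, each of the two mixed terms of \<open>Gam2\<close>
  equals \<open>- lam\<close> times \<open>Gam E w f f x\<close>.\<close>

lemma eigen_Gam2:
  assumes x: "x \<in> V"
  shows "Gam2 E w f f x = 1 / 4 * laplacian E w (grad_sq E w f) x + lam / 2 * grad_sq E w f x"
proof -
  have "laplacian E w (laplacian E w f) x = - lam * laplacian E w f x"
    unfolding laplacian_cmult[symmetric] by (rule laplacian_cong[OF x]) (simp add: eigen)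
  moreover have "laplacian E w (\<lambda>z. f z * laplacian E w f z) x
      = laplacian E w (\<lambda>z. - lam * (f z)\<^sup>2) x"
    by (rule laplacian_cong[OF x]) (simp add: eigen power2_eq_square)
  then have "laplacian E w (\<lambda>z. f z * laplacian E w f z) x
      = - lam * laplacian E w (\<lambda>z. (f z)\<^sup>2) x"
    unfolding laplacian_cmult .
  ultimately have "Gam E w f (laplacian E w f) x = - lam / 2 * grad_sq E w f x"
    using eigen_laplacian_power2[OF x] eigen[OF x]
    unfolding Gam_def by (simp add: power2_eq_square[of "f x"] algebra_simps)
  \<comment> \<open>\<open>Gam_self\<close> is made an equation between functions by
    \<open>ext\<close>, because it has to rewrite the argument of the Laplacian.\<close>
  moreover have "laplacian E w (Gam E w f f) x = 1 / 2 * laplacian E w (grad_sq E w f) x"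
    using laplacian_cmult[of E w "1 / 2" "grad_sq E w f" x]
    by (simp only: ext[of "Gam E w f f", OF Gam_self])
  ultimately show ?thesis
    by (simp add: Gam2_def)
qed

text \<open>This is the curvature condition for \<open>f\<close> multiplied by 4, with
  \<open>Gam2\<close> replaced by the formula of \<open>eigen_Gam2\<close>.\<close>

lemma eigen_laplacian_grad_sq:
  assumes "CD V E w m \<kappa>" and x: "x \<in> V"
  shows "4 * real_of_ereal (1 / m) * lam\<^sup>2 * (f x)\<^sup>2 + 2 * (\<kappa> - lam) * grad_sq E w f x
    \<le> laplacian E w (grad_sq E w f) x"
proof -
  have "real_of_ereal (1 / m) * (laplacian E w f x)\<^sup>2 + \<kappa> * Gam E w f f x \<le> Gam2 E w f f x"
    using assms unfolding CD_def by blast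
  then show ?thesis
    by (simp add: eigen_Gam2[OF x] Gam_self eigen[OF x] power_mult_distrib algebra_simps)
qed

text \<open>A Lichnerowicz-type bound: at a maximum of \<open>grad_sq E w f\<close> the Laplacian
  and minus the dimension term are both \<le> 0, and the gradient is positive there.\<close>

lemma curvature_le_eigenvalue:
  assumes CD: "CD V E w m \<kappa>" and m: "0 \<le> m"
    and nz: "\<exists>x\<in>V. f x \<noteq> 0" "lam \<noteq> 0"
  shows "\<kappa> \<le> lam"
proof -
  obtain x where x: "x \<in> V" "\<And>y. y \<in> V \<Longrightarrow> grad_sq E w f y \<le> grad_sq E w f x"
      "laplacian E w (grad_sq E w f) x \<le> 0"
    using maximum_principle[of "grad_sq E w f"] by blast
  obtain z where z: "z \<in> V" "f z \<noteq> 0"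
    using nz by blast
  \<comment> \<open>Otherwise the Laplacian of \<open>f\<close> would vanish at \<open>z\<close>,
    but it is \<open>- lam * f z\<close>.\<close>
  then have "grad_sq E w f z \<noteq> 0"
    using grad_sq_eq_0_imp_laplacian[of f z] eigen nz(2) by auto
  then have pos: "0 < grad_sq E w f x"
    using x(2)[OF z(1)] grad_sq_nonneg[of f z] by linarith
  have "0 \<le> real_of_ereal (1 / m)"
    using m by (simp add: real_of_ereal_pos)
  then have "0 \<le> 4 * real_of_ereal (1 / m) * lam\<^sup>2 * (f x)\<^sup>2"
    by simp
  with eigen_laplacian_grad_sq[OF CD x(1)] x(3) have "(\<kappa> - lam) * grad_sq E w f x \<le> 0"
    by linarith
  with pos show ?thesis
    by (simp add: mult_le_0_iff)
qed

end

end

theorem theorem3p3: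
  fixes V :: "'a set" and E :: "('a \<times> 'a) set" and w :: "'a \<Rightarrow> 'a \<Rightarrow> real"
    and m :: ereal and \<kappa> lam :: real and f :: "'a \<Rightarrow> real"
  assumes "weighted_graph V E w"
    and "1 < m"
    and "CD V E w m \<kappa>"
    and "harmonic_eigenfunction V E w lam f"
    and "lam \<noteq> 0"
  shows "\<forall>x\<in>V. grad_sq E w f x
    \<le> ((8 - real_of_ereal (2 / m)) * lam - 4 * \<kappa>) * Max ((\<lambda>z. (f z)\<^sup>2) ` V)"
proof -
  interpret weighted_graph V E w
    by fact
  have eigen: "laplacian E w f x = - lam * f x" if "x \<in> V" for x
    using assms(4) that unfolding harmonic_eigenfunction_def by fastforce
  have nz: "\<exists>x\<in>V. f x \<noteq> 0"
    using assms(4) unfolding harmonic_eigenfunction_def by blast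
  have m: "0 \<le> m"
    using assms(2) by (metis order.strict_implies_order order_trans zero_less_one_ereal)
  have lam: "0 < lam"
    using eigenvalue_pos[OF eigen nz assms(5)] .
  have kappa: "\<kappa> \<le> lam"
    using curvature_le_eigenvalue[OF eigen assms(3) m nz assms(5)] .
  define r where "r = real_of_ereal (1 / m)"
  \<comment> \<open>For infinite \<open>m\<close> both sides are 0.\<close>
  have r2: "real_of_ereal (2 / m) = 2 * r"
    unfolding r_def using assms(2) by (cases m) (auto simp: one_ereal_def)
  define a where "a = 4 * lam - 2 * \<kappa>"
  have a: "0 \<le> a"
    unfolding a_def using lam kappa by simp
  let ?g = "grad_sq E w f"
  let ?h = "\<lambda>z. ?g z + a * (f z)\<^sup>2"
  obtain x where x: "x \<in> V" "\<And>y. y \<in> V \<Longrightarrow> ?h y \<le> ?h x" "laplacian E w ?h x \<le> 0"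
    using maximum_principle[of ?h] by blast
  have "laplacian E w ?g x + a * (?g x - 2 * lam * (f x)\<^sup>2) \<le> 0"
    using x(3) eigen_laplacian_power2[OF eigen x(1)] by (simp add: laplacian_add laplacian_cmult)
  then have "4 * r * lam\<^sup>2 * (f x)\<^sup>2 + 2 * (\<kappa> - lam) * ?g x
      + a * (?g x - 2 * lam * (f x)\<^sup>2) \<le> 0"
    using eigen_laplacian_grad_sq[OF eigen assms(3) x(1)] unfolding r_def by linarith
  \<comment> \<open>The coefficient of \<open>?g x\<close> is
    \<open>2 * (\<kappa> - lam) + a = 2 * lam\<close>; the terms in \<open>(f x)\<^sup>2\<close>
    contain the same factor.\<close>
  then have "(2 * lam) * ?g x \<le> (2 * lam) * ((a - 2 * r * lam) * (f x)\<^sup>2)"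
    unfolding a_def by (simp add: power2_eq_square algebra_simps)
  then have gx: "?g x \<le> (a - 2 * r * lam) * (f x)\<^sup>2"
    using lam by simp
  define c where "c = (8 - real_of_ereal (2 / m)) * lam - 4 * \<kappa>"
  \<comment> \<open>Adding \<open>a * (f x)\<^sup>2\<close> gives the factor
    \<open>2 * a - 2 * r * lam\<close>, which is \<open>c\<close>.\<close>
  have hx: "?h x \<le> c * (f x)\<^sup>2"
    using gx unfolding c_def r2 a_def by (simp add: algebra_simps)
  \<comment> \<open>With \<open>\<kappa> \<le> lam\<close> this yields
    \<open>c \<ge> 2 * lam\<close>. The sign of \<open>c\<close> matters because \<open>x\<close>
    maximizes \<open>?h\<close>, so \<open>(f x)\<^sup>2\<close> is only bounded by the maximum of
    the squares.\<close>
  have "r \<le> 1"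
    unfolding r_def using assms(2) by (cases m) (auto simp: one_ereal_def field_simps)
  then have "r * lam \<le> lam"
    using lam by simp
  then have c: "0 \<le> c"
    using lam kappa unfolding c_def r2 left_diff_distrib by linarith
  have fx: "(f x)\<^sup>2 \<le> Max ((\<lambda>z. (f z)\<^sup>2) ` V)"
    using finite_V x(1) by simp
  have "?g y \<le> c * Max ((\<lambda>z. (f z)\<^sup>2) ` V)" if "y \<in> V" for y
  proof -
    have "?g y \<le> ?h y"
      using a by simp
    also have "\<dots> \<le> ?h x"
      using x(2) that .
    also have "\<dots> \<le> c * (f x)\<^sup>2"
      using hx .
    also have "\<dots> \<le> c * Max ((\<lambda>z. (f z)\<^sup>2) ` V)"
      using fx c by (rule mult_left_mono)
    finally show ?thesis .
  qed
  then show ?thesis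
    unfolding c_def by blast
qed

end
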